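(* Let $\mathbf g,\mathbf h,\mathbf i\in E$ with $(\mathbf 1,\mathbf g,\mathbf 1),(\mathbf 1,\mathbf h,\mathbf 1),(\mathbf 1,\mathbf i,\mathbf 1)\in\mathbb{P}$. Then $(\mathbf 1,\mathbf g\cup\mathbf h,\mathbf 1)\in\mathbb{P}$, and the coefficient of $C_{\mathbf i}$ in the expansion of $C_{\mathbf g}C_{\mathbf h}$ with respect to the basis $\{C_{\mathbf a}:(\mathbf 1,\mathbf a,\mathbf 1)\in\mathbb{P}\}$ of $\mathrm{Z}(\mathbb{T})$ equals $\delta_{\mathbf i,\mathbf g\cup\mathbf h}\,\overline{k_{\mathbf g\cap\mathbf h}}$.
   Context: Let $\mathbb{F}$ be a field; $\overline m$ is the image in $\mathbb{F}$ of an integer $m$, $\delta$ the Kronecker delta. Let $n\ge 1$ and let $U_1,\dots,U_n$ be finite sets with $|U_h|\ge 2$. Put $X=U_1\times\cdots\times U_n$ and $E=\{0,1\}^n$; $\mathbf 1$ is the all-one tuple. For $\mathbf g\in E$ let $S(\mathbf g)=\{a:\mathbf g_a=1\}$; $\mathbf g\cup\mathbf h$, $\mathbf g\cap\mathbf h$, $\mathbf g\setminus\mathbf h$ denote the elements of $E$ with supports $S(\mathbf g)\cup S(\mathbf h)$, $S(\mathbf g)\cap S(\mathbf h)$, $S(\mathbf g)\setminus S(\mathbf h)$. For $V\subseteq\{1,\dots,n\}$ let $V^\circ=\{a\in V:|U_a|>2\}$. Let $R_{\mathbf g}=\{(\mathbf y,\mathbf z)\in X\times X:\ \mathbf y_a\neq\mathbf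 z_a\iff\mathbf g_a=1\}$ and $k_{\mathbf g}=\prod_{a\in S(\mathbf g)}(|U_a|-1)$ ($k_{\mathbf 0}=1$). Let $A_{\mathbf g}\in\mathrm{M}_X(\mathbb{F})$ be the $\{0,1\}$ adjacency matrix of $R_{\mathbf g}$. Fix $\mathbf x\in X$ and let $E^*_{\mathbf g}$ be the diagonal matrix with $(\mathbf y,\mathbf y)$-entry $1$ iff $(\mathbf x,\mathbf y)\in R_{\mathbf g}$, else $0$. $\mathbb{T}$ is the $\mathbb{F}$-subalgebra of $\mathrm{M}_X(\mathbb{F})$ generated by all $A_{\mathbf g},E^*_{\mathbf g}$, and $\mathrm{Z}(\mathbb{T})$ its center. Let $\mathbb{P}$ be the set of $(\mathbf a,\mathbf b,\mathbf c)\in E^3$ with $S(\mathbf a)\triangle S(\mathbf c)\subseteq S(\mathbf b)\subseteq(S(\mathbf a)\triangle S(\mathbf c))\cup(S(\mathbf a)\cap S(\mathbf c))^\circ$. For $(\mathbf g,\mathbf h,\mathbf i)\in\mathbb{P}$ let $B_{\mathbf g,\mathbf h,\mathbf i}=\sum_{\mathbf j}E^*_{\mathbf g}A_{\mathbf j}E^*_{\mathbf i}$ over all $\mathbf j\in E$ with $S(\mathbf g)\triangle S(\mathbf i)\subseteq S(\mathbf j)\subseteq S(\mathbf h)$. For $\mathbf g\in E$ with $(\mathbf 1,\mathbf g,\mathbf 1)\in\mathbb{P}$ let $C_{\mathbf g}=\sum_{\mathbf h\in E}\overline{k_{\mathbf g\setminus\mathbf h}}B_{\mathbf h,\mathbf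 g\cap\mathbf h,\mathbf h}$; the set $\{C_{\mathbf a}:(\mathbf 1,\mathbf a,\mathbf 1)\in\mathbb{P}\}$ is an $\mathbb{F}$-basis of $\mathrm{Z}(\mathbb{T})$. *)

theory Defs
  imports Complex_Main "HOL-Library.FuncSet" "HOL-Library.Function_Algebras"
begin

text \<open>
  The matrix algebra over a finite index set \<open>X\<close> consists of the functions vanishing outside
  \<open>X \<times> X\<close>. Addition, zero and finite sums are the pointwise ones of
  \<^theory>\<open>HOL-Library.Function_Algebras\<close>; the pointwise product of that theory is not used, matrix
  multiplication is \<open>mat_mult X\<close>.
\<close>

type_synonym ('i, 'f) matrix = "'i \<Rightarrow> 'i \<Rightarrow> 'f"

definition mat_scale :: "'f \<Rightarrow> ('i, 'f::field) matrix \<Rightarrow> ('i, 'f) matrix" where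
  "mat_scale c M = (\<lambda>y z. c * M y z)"

definition mat_mult :: "'i set \<Rightarrow> ('i, 'f::field) matrix \<Rightarrow> ('i, 'f) matrix \<Rightarrow> ('i, 'f) matrix" where
  "mat_mult X M N = (\<lambda>y z. \<Sum>w\<in>X. M y w * N w z)"

definition mat_one :: "'i set \<Rightarrow> ('i, 'f::field) matrix" where
  "mat_one X = (\<lambda>y z. if y = z \<and> y \<in> X then 1 else 0)"

global_interpretation mat: vector_space "mat_scale :: 'f::field \<Rightarrow> ('i, 'f) matrix \<Rightarrow> ('i, 'f) matrix"
  by unfold_locales (auto simp: mat_scale_def fun_eq_iff algebra_simps)

inductive_set gen_algebra :: "'i set \<Rightarrow> ('i, 'f::field) matrix set \<Rightarrow> ('i, 'f) matrix set"
  for X :: "'i set" and G :: "('i, 'f) matrix set" where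
  one: "mat_one X \<in> gen_algebra X G"
| gen: "M \<in> G \<Longrightarrow> M \<in> gen_algebra X G"
| add: "M \<in> gen_algebra X G \<Longrightarrow> N \<in> gen_algebra X G \<Longrightarrow> M + N \<in> gen_algebra X G"
| scale: "M \<in> gen_algebra X G \<Longrightarrow> mat_scale c M \<in> gen_algebra X G"
| mult: "M \<in> gen_algebra X G \<Longrightarrow> N \<in> gen_algebra X G \<Longrightarrow> mat_mult X M N \<in> gen_algebra X G"

definition center :: "'i set \<Rightarrow> ('i, 'f::field) matrix set \<Rightarrow> ('i, 'f) matrix set" where
  "center X T = {M \<in> T. \<forall>N\<in>T. mat_mult X M N = mat_mult X N M}"

definition XX :: "nat \<Rightarrow> (nat \<Rightarrow> 'a set) \<Rightarrow> (nat \<Rightarrow> 'a) set" where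
  "XX n U = (\<Pi>\<^sub>E a\<in>{1..n}. U a)"

definition EE :: "nat \<Rightarrow> (nat \<Rightarrow> nat) set" where
  "EE n = (\<Pi>\<^sub>E a\<in>{1..n}. {0, 1})"

definition supp :: "nat \<Rightarrow> (nat \<Rightarrow> nat) \<Rightarrow> nat set" where
  "supp n g = {a \<in> {1..n}. g a = 1}"

definition tup :: "nat \<Rightarrow> nat set \<Rightarrow> (nat \<Rightarrow> nat)" where
  "tup n V = (\<lambda>a\<in>{1..n}. if a \<in> V then 1 else 0)"

definition all_one :: "nat \<Rightarrow> (nat \<Rightarrow> nat)" where
  "all_one n = (\<lambda>a\<in>{1..n}. 1)"

definition tup_union :: "nat \<Rightarrow> (nat \<Rightarrow> nat) \<Rightarrow> (nat \<Rightarrow> nat) \<Rightarrow> (nat \<Rightarrow> nat)" where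
  "tup_union n g h = tup n (supp n g \<union> supp n h)"

definition tup_inter :: "nat \<Rightarrow> (nat \<Rightarrow> nat) \<Rightarrow> (nat \<Rightarrow> nat) \<Rightarrow> (nat \<Rightarrow> nat)" where
  "tup_inter n g h = tup n (supp n g \<inter> supp n h)"

definition tup_diff :: "nat \<Rightarrow> (nat \<Rightarrow> nat) \<Rightarrow> (nat \<Rightarrow> nat) \<Rightarrow> (nat \<Rightarrow> nat)" where
  "tup_diff n g h = tup n (supp n g - supp n h)"

definition circ :: "(nat \<Rightarrow> 'a set) \<Rightarrow> nat set \<Rightarrow> nat set" where
  "circ U V = {a \<in> V. card (U a) > 2}"

definition RR :: "nat \<Rightarrow> (nat \<Rightarrow> 'a set) \<Rightarrow> (nat \<Rightarrow> nat) \<Rightarrow> ((nat \<Rightarrow> 'a) \<times> (nat \<Rightarrow> 'a)) set" where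
  "RR n U g = {(y, z) \<in> XX n U \<times> XX n U. \<forall>a\<in>{1..n}. y a \<noteq> z a \<longleftrightarrow> g a = 1}"

definition kk :: "nat \<Rightarrow> (nat \<Rightarrow> 'a set) \<Rightarrow> (nat \<Rightarrow> nat) \<Rightarrow> nat" where
  "kk n U g = (\<Prod>a\<in>supp n g. card (U a) - 1)"

definition adj :: "nat \<Rightarrow> (nat \<Rightarrow> 'a set) \<Rightarrow> (nat \<Rightarrow> nat) \<Rightarrow> (nat \<Rightarrow> 'a, 'f::field) matrix" where
  "adj n U g = (\<lambda>y z. if (y, z) \<in> RR n U g then 1 else 0)"

definition dual_idem ::
  "nat \<Rightarrow> (nat \<Rightarrow> 'a set) \<Rightarrow> (nat \<Rightarrow> 'a) \<Rightarrow> (nat \<Rightarrow> nat) \<Rightarrow> (nat \<Rightarrow> 'a, 'f::field) matrix" where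
  "dual_idem n U x g = (\<lambda>y z. if y = z \<and> (x, y) \<in> RR n U g then 1 else 0)"

definition TT :: "nat \<Rightarrow> (nat \<Rightarrow> 'a set) \<Rightarrow> (nat \<Rightarrow> 'a) \<Rightarrow> (nat \<Rightarrow> 'a, 'f::field) matrix set" where
  "TT n U x = gen_algebra (XX n U) (adj n U ` EE n \<union> dual_idem n U x ` EE n)"

definition PP ::
  "nat \<Rightarrow> (nat \<Rightarrow> 'a set) \<Rightarrow> ((nat \<Rightarrow> nat) \<times> (nat \<Rightarrow> nat) \<times> (nat \<Rightarrow> nat)) set" where
  "PP n U = {(a, b, c) \<in> EE n \<times> EE n \<times> EE n.
     sym_diff (supp n a) (supp n c) \<subseteq> supp n b \<and>
     supp n b \<subseteq> sym_diff (supp n a) (supp n c) \<union> circ U (supp n a \<inter> supp n c)}"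

definition BB ::
  "nat \<Rightarrow> (nat \<Rightarrow> 'a set) \<Rightarrow> (nat \<Rightarrow> 'a) \<Rightarrow> (nat \<Rightarrow> nat) \<Rightarrow> (nat \<Rightarrow> nat) \<Rightarrow> (nat \<Rightarrow> nat)
     \<Rightarrow> (nat \<Rightarrow> 'a, 'f::field) matrix" where
  "BB n U x g h i =
     (\<Sum>j\<in>{j \<in> EE n. sym_diff (supp n g) (supp n i) \<subseteq> supp n j \<and> supp n j \<subseteq> supp n h}.
        mat_mult (XX n U) (mat_mult (XX n U) (dual_idem n U x g) (adj n U j)) (dual_idem n U x i))"

definition CC ::
  "nat \<Rightarrow> (nat \<Rightarrow> 'a set) \<Rightarrow> (nat \<Rightarrow> 'a) \<Rightarrow> (nat \<Rightarrow> nat) \<Rightarrow> (nat \<Rightarrow> 'a, 'f::field) matrix" where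
  "CC n U x g =
     (\<Sum>h\<in>EE n. mat_scale (of_nat (kk n U (tup_diff n g h))) (BB n U x h (tup_inter n g h) h))"

definition CC_basis :: "nat \<Rightarrow> (nat \<Rightarrow> 'a set) \<Rightarrow> (nat \<Rightarrow> 'a) \<Rightarrow> (nat \<Rightarrow> 'a, 'f::field) matrix set" where
  "CC_basis n U x = {CC n U x a | a. (all_one n, a, all_one n) \<in> PP n U}"

end

theory Submission
  imports Defs "HOL-Combinatorics.Transposition"
begin

text \<open>
  The matrix \<open>C\<^sub>g\<close> is a tensor product over the coordinates: at \<open>a \<in> S(g)\<close> the factor is
  \<open>(|U\<^sub>a| - 1) E\<^sup>*\<^sub>0 + E\<^sup>*\<^sub>1 J E\<^sup>*\<^sub>1\<close>, elsewhere it is the identity. The first factor commutes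
  with the local generators and squares to \<open>|U\<^sub>a| - 1\<close> times itself, which yields centrality and
  \<open>C\<^sub>g C\<^sub>h = k\<^bsub>g \<inter> h\<^esub> C\<^bsub>g \<union> h\<^esub>\<close>.

  On the block of points that differ from \<open>x\<close> in every coordinate, the entry of \<open>C\<^sub>g\<close> at \<open>(y, z)\<close>
  is \<open>1\<close> if \<open>y\<close> and \<open>z\<close> differ only inside \<open>S(g)\<close>, and \<open>0\<close> otherwise; inverting this unitriangular
  system gives linear independence. Every element of \<open>T\<close> is invariant under the permutations of the
  sets \<open>U\<^sub>a\<close> fixing \<open>x\<^sub>a\<close>, so on this block it depends only on the set of coordinates where \<open>y\<close> and
  \<open>z\<close> differ, and a combination of the \<open>C\<^sub>g\<close> has the same block. Finally a central matrix vanishing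
  on this block is zero, as one sees by commuting it with \<open>E\<^sup>*\<^sub>S A\<^bsub>S\<^sup>c\<^esub> E\<^sup>*\<^sub>1\<close>.
\<close>

section \<open>Pointwise sums, transpositions and inversion over supersets\<close>

lemma sum_matrix_apply:
  fixes f :: "'b \<Rightarrow> ('i, 'f::comm_monoid_add) matrix"
  shows "(\<Sum>j\<in>A. f j) y z = (\<Sum>j\<in>A. f j y z)"
  by (induction A rule: infinite_finite_induct) auto

lemma prod_if_one_zero:
  assumes "finite A"
  shows "(\<Prod>a\<in>A. if P a then 1 else (0::'f::field)) = (if \<forall>a\<in>A. P a then 1 else 0)"
  using assms by (induction A rule: finite_induct) auto

text \<open>The first swap sends \<open>u\<close> to \<open>u'\<close>, the second carries the image
  of \<open>v\<close> to \<open>v'\<close>. If \<open>u\<close> and \<open>v\<close> differ, then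
  \<open>u'\<close> differs from \<open>v'\<close> and from the image of \<open>v\<close>, so the
  second swap fixes it; if they agree, the second swap is trivial.\<close>

lemma transpose_comp_pair:
  assumes "u = v \<longleftrightarrow> u' = v'"
  shows "(transpose (transpose u u' v) v' \<circ> transpose u u') u = u'"
    and "(transpose (transpose u u' v) v' \<circ> transpose u u') v = v'"
  using assms by (auto simp: transpose_def)

text \<open>The inclusion matrix of subsets is unitriangular, hence invertible over any abelian
  group. The induction splits the sets \<open>G\<close> by whether they contain the new element
  \<open>a\<close>: those that do are solved for \<open>m (insert a D)\<close>, the others make up
  the difference to \<open>m D\<close>.\<close>

lemma superset_sum_solvable:
  fixes m :: "'b set \<Rightarrow> 'f::ab_group_add"
  assumes "finite F"
  shows "\<exists>c. \<forall>D\<subseteq>F. (\<Sum>G\<in>{G\<in>Pow F. D \<subseteq> G}. c G) = m D"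
  using assms
proof (induction F arbitrary: m rule: finite_induct)
  case empty
  have *: "{G\<in>Pow {}. D \<subseteq> G} = {{}}" if "D \<subseteq> {}" for D :: "'b set"
    using that by auto
  show ?case
    by (intro exI[of _ m]) (auto simp: *)
next
  case (insert a F)
  obtain c1 where c1: "\<And>D. D \<subseteq> F \<Longrightarrow> (\<Sum>G\<in>{G\<in>Pow F. D \<subseteq> G}. c1 G) = m (insert a D)"
    using insert.IH[of "\<lambda>D. m (insert a D)"] by auto
  obtain c0 where c0: "\<And>D. D \<subseteq> F \<Longrightarrow> (\<Sum>G\<in>{G\<in>Pow F. D \<subseteq> G}. c0 G) = m D - m (insert a D)"
    using insert.IH[of "\<lambda>D. m D - m (insert a D)"] by auto
  define c where "c G = (if a \<in> G then c1 (G - {a}) else c0 G)" for G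
  have with_a: "(\<Sum>G\<in>insert a ` {G\<in>Pow F. D \<subseteq> G}. c G) = m (insert a D)" if "D \<subseteq> F" for D
  proof -
    have "inj_on (insert a) {G\<in>Pow F. D \<subseteq> G}"
      using insert.hyps(2) by (intro inj_onI) (metis (no_types, lifting) Pow_iff insert_ident mem_Collect_eq subsetD)
    moreover have "c (insert a G) = c1 G" if "G \<subseteq> F" for G
    proof -
      have "insert a G - {a} = G" using that insert.hyps(2) by auto
      then show ?thesis by (simp add: c_def)
    qed
    ultimately show ?thesis
      unfolding c1[OF that, symmetric] by (subst sum.reindex) (auto intro: sum.cong)
  qed
  have "(\<Sum>G\<in>{G\<in>Pow (insert a F). D \<subseteq> G}. c G) = m D" if D: "D \<subseteq> insert a F" for D
  proof (cases "a \<in> D")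
    case True
    have "{G\<in>Pow (insert a F). D \<subseteq> G} = insert a ` {G\<in>Pow F. D - {a} \<subseteq> G}"
    proof (intro equalityI subsetI)
      fix G assume "G \<in> {G\<in>Pow (insert a F). D \<subseteq> G}"
      then have "G = insert a (G - {a})" "G - {a} \<in> {G\<in>Pow F. D - {a} \<subseteq> G}"
        using True by auto
      then show "G \<in> insert a ` {G\<in>Pow F. D - {a} \<subseteq> G}" by blast
    qed auto
    moreover have "insert a (D - {a}) = D" "D - {a} \<subseteq> F" using True D by auto
    ultimately show ?thesis using with_a[of "D - {a}"] by simp
  next
    case False
    then have DF: "D \<subseteq> F" using D by auto
    have "{G\<in>Pow (insert a F). D \<subseteq> G} = {G\<in>Pow F. D \<subseteq> G} \<union> insert a ` {G\<in>Pow F. D \<subseteq> G}"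
    proof (intro equalityI subsetI)
      fix G assume G: "G \<in> {G\<in>Pow (insert a F). D \<subseteq> G}"
      show "G \<in> {G\<in>Pow F. D \<subseteq> G} \<union> insert a ` {G\<in>Pow F. D \<subseteq> G}"
      proof (cases "a \<in> G")
        case True
        then have "G = insert a (G - {a})" "G - {a} \<in> {G\<in>Pow F. D \<subseteq> G}"
          using G False by auto
        then show ?thesis by blast
      qed (use G in auto)
    qed auto
    moreover have "{G\<in>Pow F. D \<subseteq> G} \<inter> insert a ` {G\<in>Pow F. D \<subseteq> G} = {}"
      using insert.hyps(2) by auto
    moreover have "(\<Sum>G\<in>{G\<in>Pow F. D \<subseteq> G}. c G) = m D - m (insert a D)"
      unfolding c0[OF DF, symmetric] using insert.hyps(2) by (intro sum.cong) (auto simp: c_def)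
    ultimately show ?thesis
      using with_a[OF DF] insert.hyps(1) by (simp add: sum.union_disjoint)
  qed
  then show ?case by blast
qed

text \<open>A maximal set with nonzero coefficient would be the only contributor to its own superset
  sum.\<close>

lemma superset_sum_eq_zeroD:
  fixes c :: "'b set \<Rightarrow> 'f::comm_monoid_add"
  assumes "finite F" and zero: "\<And>D. D \<subseteq> F \<Longrightarrow> (\<Sum>G\<in>{G\<in>Pow F. D \<subseteq> G}. c G) = 0"
    and "G \<subseteq> F"
  shows "c G = 0"
proof (rule ccontr)
  assume "c G \<noteq> 0"
  then have "finite {H\<in>Pow F. c H \<noteq> 0}" "{H\<in>Pow F. c H \<noteq> 0} \<noteq> {}"
    using assms(1,3) by auto
  from finite_has_maximal[OF this] obtain D
    where "D \<in> {H\<in>Pow F. c H \<noteq> 0}" and "\<forall>H\<in>{H\<in>Pow F. c H \<noteq> 0}. D \<subseteq> H \<longrightarrow> D = H"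
    by blast
  then have D: "D \<subseteq> F" "c D \<noteq> 0"
    and max: "\<And>H. H \<subseteq> F \<Longrightarrow> c H \<noteq> 0 \<Longrightarrow> D \<subseteq> H \<Longrightarrow> D = H"
    by simp_all
  have "(\<Sum>G\<in>{G\<in>Pow F. D \<subseteq> G}. c G) = (\<Sum>G\<in>{D}. c G)"
    using assms(1) D max by (intro sum.mono_neutral_right) auto
  then show False using zero[OF D(1)] D(2) by simp
qed

section \<open>Generated matrix algebras and their centers\<close>

lemma gen_algebra_zero: "0 \<in> gen_algebra X G"
proof -
  have "mat_scale 0 (mat_one X) = (0 :: ('a, 'b) matrix)"
    by (simp add: mat_scale_def fun_eq_iff)
  then show ?thesis by (metis gen_algebra.one gen_algebra.scale)
qed

lemma gen_algebra_sum:
  "(\<And>j. j \<in> A \<Longrightarrow> f j \<in> gen_algebra X G) \<Longrightarrow> (\<Sum>j\<in>A. f j) \<in> gen_algebra X G"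
  by (induction A rule: infinite_finite_induct)
    (auto intro: gen_algebra_zero gen_algebra.add)

lemma mat_mult_assoc:
  assumes "finite X"
  shows "mat_mult X (mat_mult X K M) N = mat_mult X K (mat_mult X M N)"
proof (intro ext)
  fix y z
  have "mat_mult X (mat_mult X K M) N y z = (\<Sum>w\<in>X. \<Sum>v\<in>X. K y v * M v w * N w z)"
    by (simp add: mat_mult_def sum_distrib_right)
  also have "\<dots> = (\<Sum>v\<in>X. \<Sum>w\<in>X. K y v * M v w * N w z)"
    by (rule sum.swap)
  also have "\<dots> = mat_mult X K (mat_mult X M N) y z"
    by (simp add: mat_mult_def sum_distrib_left mult.assoc)
  finally show "mat_mult X (mat_mult X K M) N y z = mat_mult X K (mat_mult X M N) y z" .
qed

lemma mat_mult_add_left: "mat_mult X (M + M') N = mat_mult X M N + mat_mult X M' N"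
  by (simp add: mat_mult_def fun_eq_iff distrib_right sum.distrib)

lemma mat_mult_add_right: "mat_mult X N (M + M') = mat_mult X N M + mat_mult X N M'"
  by (simp add: mat_mult_def fun_eq_iff distrib_left sum.distrib)

lemma mat_mult_scale_left: "mat_mult X (mat_scale c M) N = mat_scale c (mat_mult X M N)"
  by (simp add: mat_mult_def mat_scale_def fun_eq_iff sum_distrib_left mult.assoc)

lemma mat_mult_scale_right: "mat_mult X N (mat_scale c M) = mat_scale c (mat_mult X N M)"
  by (simp add: mat_mult_def mat_scale_def fun_eq_iff sum_distrib_left mult.left_commute)

lemma subspace_center: "mat.subspace (center X (gen_algebra X G))"
proof (rule mat.subspaceI)
  show "0 \<in> center X (gen_algebra X G)"
    by (auto simp: center_def gen_algebra_zero mat_mult_def)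
qed (auto simp: center_def mat_mult_add_left mat_mult_add_right mat_mult_scale_left
    mat_mult_scale_right intro: gen_algebra.add gen_algebra.scale)

text \<open>Commuting with \<open>M\<close> is preserved by the algebra operations, so generators
  suffice. The support condition makes \<open>mat_one X\<close> a unit for \<open>M\<close>.\<close>

lemma center_gen_algebraI:
  assumes "finite X" and M: "M \<in> gen_algebra X G"
    and supp: "\<And>y z. y \<notin> X \<or> z \<notin> X \<Longrightarrow> M y z = 0"
    and gen: "\<And>N. N \<in> G \<Longrightarrow> mat_mult X M N = mat_mult X N M"
  shows "M \<in> center X (gen_algebra X G)"
proof -
  have "mat_mult X M N = mat_mult X N M" if "N \<in> gen_algebra X G" for N
    using that
  proof induction
    case one
    have "mat_mult X M (mat_one X) = M"
      using assms(1) supp by (auto simp: mat_mult_def mat_one_def fun_eq_iff if_distrib cong: if_cong)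
    moreover have "mat_mult X (mat_one X) M = M"
    proof (intro ext)
      fix y z
      have "mat_mult X (mat_one X) M y z = (\<Sum>w\<in>X. if w = y then M y z else 0)"
        unfolding mat_mult_def mat_one_def by (intro sum.cong) auto
      then show "mat_mult X (mat_one X) M y z = M y z"
        using assms(1) supp by (simp)
    qed
    ultimately show ?case by simp
  next
    case (add K N)
    then show ?case
      by (simp add: mat_mult_def fun_eq_iff distrib_left distrib_right sum.distrib)
  next
    case (mult K N)
    have "mat_mult X M (mat_mult X K N) = mat_mult X (mat_mult X K M) N"
      using mult.IH assms(1) by (simp flip: mat_mult_assoc)
    also have "\<dots> = mat_mult X (mat_mult X K N) M"
      using mult.IH assms(1) by (simp add: mat_mult_assoc)
    finally show ?case .
  qed (simp_all add: gen mat_mult_scale_left mat_mult_scale_right)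
  then show ?thesis using M by (simp add: center_def)
qed

section \<open>Tuples and their supports\<close>

lemma supp_tup [simp]: "supp n (tup n V) = V \<inter> {1..n}"
  by (auto simp: supp_def tup_def)

lemma tup_in_EE [simp]: "tup n V \<in> EE n"
  by (auto simp: tup_def EE_def)

lemma tup_supp: "g \<in> EE n \<Longrightarrow> tup n (supp n g) = g"
  by (rule extensionalityI[of _ "{1..n}"]) (auto simp: tup_def supp_def EE_def PiE_iff)

lemma supp_subset: "supp n g \<subseteq> {1..n}"
  by (auto simp: supp_def)

lemma finite_EE [simp]: "finite (EE n)"
  by (simp add: EE_def finite_PiE)

text \<open>Here the symmetric difference is empty and the intersection is everything. The basis
  indices thus correspond to the subsets of \<open>circ U {1..n}\<close>.\<close>

lemma all_one_PP_iff:
  "(all_one n, g, all_one n) \<in> PP n U \<longleftrightarrow> g \<in> EE n \<and> supp n g \<subseteq> circ U {1..n}"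
proof -
  have "supp n (all_one n) = {1..n}" "all_one n \<in> EE n"
    by (auto simp: all_one_def supp_def EE_def)
  then show ?thesis by (simp add: PP_def)
qed

text \<open>
  The parameter \<open>field_type\<close> only fixes the coefficient field, so that the matrices defined in the
  locale have one type throughout each proof.
\<close>

locale factorial_scheme =
  fixes n :: nat and U :: "nat \<Rightarrow> 'a set" and x :: "nat \<Rightarrow> 'a"
    and field_type :: "'f::field itself"
  assumes finite_U: "\<And>a. a \<in> {1..n} \<Longrightarrow> finite (U a)"
    and card_U: "\<And>a. a \<in> {1..n} \<Longrightarrow> card (U a) \<ge> 2"
    and base_point: "x \<in> XX n U"
begin

declare One_nat_def [simp del]

section \<open>Tensor products over the coordinates\<close>

abbreviation "X \<equiv> XX n U"

lemma finite_X [simp]: "finite X"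
  unfolding XX_def using finite_U by (intro finite_PiE) auto

lemma X_D: "y \<in> X \<Longrightarrow> a \<in> {1..n} \<Longrightarrow> y a \<in> U a"
  by (auto simp: XX_def)

lemma X_eqI: "y \<in> X \<Longrightarrow> z \<in> X \<Longrightarrow> (\<And>a. a \<in> {1..n} \<Longrightarrow> y a = z a) \<Longrightarrow> y = z"
  unfolding XX_def by (rule PiE_ext)

definition ten :: "(nat \<Rightarrow> ('a, 'f) matrix) \<Rightarrow> (nat \<Rightarrow> 'a, 'f) matrix" where
  "ten f = (\<lambda>y z. if y \<in> X \<and> z \<in> X then \<Prod>a\<in>{1..n}. f a (y a) (z a) else 0)"

lemma ten_cong:
  assumes "\<And>a u v. a \<in> {1..n} \<Longrightarrow> u \<in> U a \<Longrightarrow> v \<in> U a \<Longrightarrow> f a u v = g a u v"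
  shows "ten f = ten g"
  using assms X_D by (auto simp: ten_def fun_eq_iff intro!: prod.cong)

text \<open>The mixed-product rule: a sum over \<open>X\<close> of products over the coordinates
  factors, since \<open>X\<close> is a full product of sets.\<close>

lemma ten_mult: "mat_mult X (ten f) (ten g) = ten (\<lambda>a. mat_mult (U a) (f a) (g a))"
proof (intro ext)
  fix y z
  show "mat_mult X (ten f) (ten g) y z = ten (\<lambda>a. mat_mult (U a) (f a) (g a)) y z"
  proof (cases "y \<in> X \<and> z \<in> X")
    case True
    then have "mat_mult X (ten f) (ten g) y z
        = (\<Sum>w\<in>X. \<Prod>a\<in>{1..n}. f a (y a) (w a) * g a (w a) (z a))"
      by (simp add: mat_mult_def ten_def prod.distrib)
    also have "\<dots> = (\<Prod>a\<in>{1..n}. \<Sum>u\<in>U a. f a (y a) u * g a u (z a))"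
      unfolding XX_def by (rule prod_sum_PiE[symmetric]) (use finite_U in auto)
    finally show ?thesis using True by (simp add: ten_def mat_mult_def)
  qed (auto simp: mat_mult_def ten_def)
qed

section \<open>Local factors at one coordinate\<close>

definition local_id :: "('a, 'f) matrix" where
  "local_id = (\<lambda>u v. if u = v then 1 else 0)"

definition local_adj :: "nat \<Rightarrow> ('a, 'f) matrix" where
  "local_adj e = (\<lambda>u v. if u \<noteq> v \<longleftrightarrow> e = 1 then 1 else 0)"

definition local_dual :: "nat \<Rightarrow> nat \<Rightarrow> ('a, 'f) matrix" where
  "local_dual a e = (\<lambda>u v. if u = v \<and> (x a \<noteq> u \<longleftrightarrow> e = 1) then 1 else 0)"

text \<open>Block diagonal for the splitting of \<open>U a\<close> into \<open>{x a}\<close> and the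
  rest. The corner value is chosen so that both blocks have the same row sum.\<close>

definition local_central :: "nat \<Rightarrow> ('a, 'f) matrix" where
  "local_central a = (\<lambda>u v. if u = x a \<and> v = x a then of_nat (card (U a) - 1)
     else if u \<noteq> x a \<and> v \<noteq> x a then 1 else 0)"

text \<open>The tensor form of \<open>CC n U x g\<close> with \<open>supp n g = G\<close>, indexed
  by a set instead of a tuple.\<close>

definition cen :: "nat set \<Rightarrow> (nat \<Rightarrow> 'a, 'f) matrix" where
  "cen G = ten (\<lambda>a. if a \<in> G then local_central a else local_id)"

lemma local_id_mult:
  assumes "a \<in> {1..n}" "u \<in> U a" "v \<in> U a"
  shows "mat_mult (U a) local_id M u v = M u v" "mat_mult (U a) M local_id u v = M u v"
proof -
  have "mat_mult (U a) local_id M u v = (\<Sum>w\<in>U a. if w = u then M u v else 0)"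
    unfolding mat_mult_def local_id_def by (intro sum.cong) auto
  then show "mat_mult (U a) local_id M u v = M u v"
    using assms finite_U by (simp)
  have "mat_mult (U a) M local_id u v = (\<Sum>w\<in>U a. if w = v then M u v else 0)"
    unfolding mat_mult_def local_id_def by (intro sum.cong) auto
  then show "mat_mult (U a) M local_id u v = M u v"
    using assms finite_U by (simp)
qed

lemma local_central_sym: "local_central a u v = local_central a v u"
  by (auto simp: local_central_def)

text \<open>Lists how a single coordinate annihilates an entry of \<open>cen\<close>: exactly one of
  the two values is \<open>x a\<close>, or the values differ where the factor is the
  identity.\<close>

lemma local_factor_zero:
  assumes "\<not> ((x a = u \<longleftrightarrow> x a = v) \<and> (u \<noteq> v \<longrightarrow> P))"
  shows "(if P then local_central a else local_id) u v = 0"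
  using assms by (cases P; cases "x a = u"; cases "x a = v") (auto simp: local_central_def local_id_def)

lemma local_central_row_sum:
  assumes "a \<in> {1..n}"
  shows "(\<Sum>w\<in>U a. local_central a u w) = of_nat (card (U a) - 1)"
proof (cases "u = x a")
  case True
  then have "(\<Sum>w\<in>U a. local_central a u w)
      = (\<Sum>w\<in>U a. if w = x a then of_nat (card (U a) - 1) else 0)"
    by (intro sum.cong) (auto simp: local_central_def)
  then show ?thesis
    using X_D[OF base_point assms] finite_U[OF assms] by (simp)
next
  case False
  then have "(\<Sum>w\<in>U a. local_central a u w) = (\<Sum>w\<in>U a - {x a}. 1)"
    using finite_U[OF assms] by (intro sum.mono_neutral_cong_right) (auto simp: local_central_def)
  then show ?thesis
    using X_D[OF base_point assms] finite_U[OF assms] by simp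
qed

text \<open>Each block is constant, so for \<open>w\<close> in the block of \<open>u\<close> and
  \<open>v\<close> the entry at \<open>(w, v)\<close> equals the one at \<open>(u, v)\<close>. It
  can be pulled out, leaving a row sum.\<close>

lemma local_central_square:
  assumes "a \<in> {1..n}" "u \<in> U a" "v \<in> U a"
  shows "mat_mult (U a) (local_central a) (local_central a) u v
    = of_nat (card (U a) - 1) * local_central a u v"
proof -
  have "mat_mult (U a) (local_central a) (local_central a) u v
      = (\<Sum>w\<in>U a. (if u = x a \<longleftrightarrow> v = x a then local_central a u v * local_central a u w else 0))"
    unfolding mat_mult_def by (intro sum.cong) (auto simp: local_central_def)
  also have "\<dots> = local_central a u v * (\<Sum>w\<in>U a. local_central a u w)"
    by (auto simp: local_central_def sum_distrib_left intro!: sum.cong)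
  finally show ?thesis
    using local_central_row_sum[OF assms(1)] by (simp add: mult.commute)
qed

text \<open>For \<open>e = 1\<close> the local adjacency matrix is the all-one matrix minus the
  identity. Both products are then a row sum minus the entry at \<open>(u, v)\<close>, and all row
  sums agree.\<close>

lemma local_central_commute_adj:
  assumes "a \<in> {1..n}" "u \<in> U a" "v \<in> U a"
  shows "mat_mult (U a) (local_central a) (local_adj e) u v
    = mat_mult (U a) (local_adj e) (local_central a) u v"
proof (cases "e = 1")
  case False
  then have "local_adj e = (local_id :: ('a, 'f) matrix)" by (simp add: local_adj_def local_id_def fun_eq_iff)
  then show ?thesis using assms by (simp add: local_id_mult)
next
  case True
  have "mat_mult (U a) (local_central a) (local_adj e) u v
      = (\<Sum>w\<in>U a. local_central a u w - (if w = v then local_central a u v else 0))"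
    using True unfolding mat_mult_def local_adj_def by (intro sum.cong) auto
  moreover have "mat_mult (U a) (local_adj e) (local_central a) u v
      = (\<Sum>w\<in>U a. local_central a v w - (if w = u then local_central a u v else 0))"
    using True unfolding mat_mult_def local_adj_def
    by (intro sum.cong) (auto simp: local_central_sym[of a _ v])
  ultimately show ?thesis
    using assms finite_U by (simp add: sum_subtractf local_central_row_sum)
qed

text \<open>\<open>local_dual a e\<close> is the projection onto one of the two blocks that
  \<open>local_central a\<close> respects.\<close>

lemma local_central_commute_dual:
  assumes "a \<in> {1..n}" "u \<in> U a" "v \<in> U a"
  shows "mat_mult (U a) (local_central a) (local_dual a e) u v
    = mat_mult (U a) (local_dual a e) (local_central a) u v"
proof -
  have "mat_mult (U a) (local_central a) (local_dual a e) u v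
      = (\<Sum>w\<in>U a. if w = v then (if x a \<noteq> v \<longleftrightarrow> e = 1 then local_central a u v else 0) else 0)"
    unfolding mat_mult_def local_dual_def by (intro sum.cong) auto
  moreover have "mat_mult (U a) (local_dual a e) (local_central a) u v
      = (\<Sum>w\<in>U a. if w = u then (if x a \<noteq> u \<longleftrightarrow> e = 1 then local_central a u v else 0) else 0)"
    unfolding mat_mult_def local_dual_def by (intro sum.cong) auto
  ultimately show ?thesis
    using assms finite_U by (auto simp: local_central_def[of a, THEN fun_cong, THEN fun_cong])
qed

section \<open>Generators in tensor form and products of the central matrices\<close>

lemma adj_eq_ten: "adj n U g = ten (\<lambda>a. local_adj (g a))"
  by (auto simp: adj_def ten_def local_adj_def RR_def prod_if_one_zero fun_eq_iff)

lemma dual_idem_eq_ten: "dual_idem n U x g = ten (\<lambda>a. local_dual a (g a))"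
proof (intro ext)
  fix y z
  have "y = z \<longleftrightarrow> (\<forall>a\<in>{1..n}. y a = z a)" if "y \<in> X" "z \<in> X"
    using X_eqI[OF that] by blast
  then show "dual_idem n U x g y z = ten (\<lambda>a. local_dual a (g a)) y z"
    using base_point by (auto simp: dual_idem_def ten_def local_dual_def RR_def prod_if_one_zero)
qed

lemma cen_commute_generator:
  assumes "N \<in> adj n U ` EE n \<union> dual_idem n U x ` EE n"
  shows "mat_mult X (cen G) N = mat_mult X N (cen G)"
proof -
  have "mat_mult X (cen G) (adj n U j) = mat_mult X (adj n U j) (cen G)" for j
    unfolding adj_eq_ten cen_def ten_mult
    by (rule ten_cong) (simp add: local_id_mult local_central_commute_adj del: atLeastAtMost_iff)
  moreover have "mat_mult X (cen G) (dual_idem n U x j) = mat_mult X (dual_idem n U x j) (cen G)" for j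
    unfolding dual_idem_eq_ten cen_def ten_mult
    by (rule ten_cong) (simp add: local_id_mult local_central_commute_dual del: atLeastAtMost_iff)
  ultimately show ?thesis using assms by auto
qed

text \<open>A coordinate in both sets contributes a square, hence the scalar; a coordinate in just
  one set contributes that factor times the identity.\<close>

lemma cen_mult:
  assumes "G \<subseteq> {1..n}" "H \<subseteq> {1..n}"
  shows "mat_mult X (cen G) (cen H)
    = mat_scale (\<Prod>a\<in>G \<inter> H. of_nat (card (U a) - 1)) (cen (G \<union> H))"
proof -
  have "mat_mult X (cen G) (cen H) = ten (\<lambda>a u v. (if a \<in> G \<inter> H then of_nat (card (U a) - 1) else 1)
      * (if a \<in> G \<union> H then local_central a else local_id) u v)"
    unfolding cen_def ten_mult
    by (rule ten_cong) (auto simp: local_id_mult local_central_square)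
  also have "\<dots> = mat_scale (\<Prod>a\<in>{1..n}. if a \<in> G \<inter> H then of_nat (card (U a) - 1) else 1) (cen (G \<union> H))"
    by (auto simp: cen_def ten_def mat_scale_def fun_eq_iff prod.distrib)
  also have "(\<Prod>a\<in>{1..n}. if a \<in> G \<inter> H then of_nat (card (U a) - 1) else (1::'f))
      = (\<Prod>a\<in>{1..n} \<inter> (G \<inter> H). of_nat (card (U a) - 1))"
    by (rule prod.inter_restrict[symmetric]) simp
  also have "{1..n} \<inter> (G \<inter> H) = G \<inter> H" using assms by auto
  finally show ?thesis .
qed

section \<open>Difference sets and the entries of \<open>CC\<close>\<close>

definition diffs :: "(nat \<Rightarrow> 'a) \<Rightarrow> (nat \<Rightarrow> 'a) \<Rightarrow> nat set" where
  "diffs y z = {a \<in> {1..n}. y a \<noteq> z a}"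

lemma in_diffs_iff: "a \<in> diffs y z \<longleftrightarrow> a \<in> {1..n} \<and> y a \<noteq> z a"
  by (simp add: diffs_def)

lemma diffs_subset: "diffs y z \<subseteq> {1..n}"
  by (auto simp: diffs_def)

lemma diffs_full_D: "diffs x y = {1..n} \<Longrightarrow> a \<in> {1..n} \<Longrightarrow> y a \<noteq> x a"
  by (metis in_diffs_iff)

lemma diffs_full_I: "(\<And>a. a \<in> {1..n} \<Longrightarrow> x a \<noteq> y a) \<Longrightarrow> diffs x y = {1..n}"
  by (auto simp: in_diffs_iff)

lemma RR_iff: "(y, z) \<in> RR n U g \<longleftrightarrow> y \<in> X \<and> z \<in> X \<and> supp n g = diffs y z"
proof -
  have "supp n g = diffs y z \<longleftrightarrow> (\<forall>a\<in>{1..n}. y a \<noteq> z a \<longleftrightarrow> g a = 1)"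
    unfolding supp_def set_eq_iff in_diffs_iff mem_Collect_eq by blast
  then show ?thesis by (simp add: RR_def)
qed

lemma dual_idem_mult_left:
  "mat_mult X (dual_idem n U x g) M y z = (if y \<in> X \<and> supp n g = diffs x y then M y z else 0)"
proof -
  have "mat_mult X (dual_idem n U x g) M y z
      = (\<Sum>w\<in>X. if w = y then (if supp n g = diffs x y then M y z else 0) else 0)"
    unfolding mat_mult_def dual_idem_def RR_iff using base_point by (intro sum.cong) auto
  then show ?thesis by simp
qed

lemma dual_idem_mult_right:
  "mat_mult X M (dual_idem n U x g) y z = (if z \<in> X \<and> supp n g = diffs x z then M y z else 0)"
proof -
  have "mat_mult X M (dual_idem n U x g) y z
      = (\<Sum>w\<in>X. if w = z then (if supp n g = diffs x z then M y z else 0) else 0)"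
    unfolding mat_mult_def dual_idem_def RR_iff using base_point by (intro sum.cong) auto
  then show ?thesis by simp
qed

lemma block_adj_apply:
  "mat_mult X (mat_mult X (dual_idem n U x g) (adj n U j)) (dual_idem n U x i) y z
    = (if y \<in> X \<and> z \<in> X \<and> supp n g = diffs x y \<and> supp n i = diffs x z \<and> supp n j = diffs y z
       then 1 else (0::'f))"
  by (auto simp: dual_idem_mult_left dual_idem_mult_right adj_def RR_iff)

text \<open>With equal outer indices the lower bound on \<open>supp n j\<close> is empty. At most
  one \<open>j\<close> contributes, the tuple with support \<open>diffs y z\<close>.\<close>

lemma BB_diagonal_apply:
  "BB n U x h k h y z
    = (if y \<in> X \<and> z \<in> X \<and> supp n h = diffs x y \<and> supp n h = diffs x z \<and> diffs y z \<subseteq> supp n k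
       then 1 else (0::'f))"
proof -
  have eq: "supp n j = diffs y z \<longleftrightarrow> j = tup n (diffs y z)" if "j \<in> EE n" for j
    using tup_supp[OF that] diffs_subset[of y z] by (auto simp: Int_absorb2)
  have "BB n U x h k h y z = (\<Sum>j\<in>{j \<in> EE n. supp n j \<subseteq> supp n k}.
      if j = tup n (diffs y z) then
        (if y \<in> X \<and> z \<in> X \<and> supp n h = diffs x y \<and> supp n h = diffs x z then 1 else (0::'f)) else 0)"
    unfolding BB_def sum_matrix_apply block_adj_apply by (intro sum.cong) (auto simp: eq)
  also have "\<dots> = (if y \<in> X \<and> z \<in> X \<and> supp n h = diffs x y \<and> supp n h = diffs x z
      \<and> diffs y z \<subseteq> supp n k then 1 else 0)"
    using diffs_subset[of y z] by (auto simp: Int_absorb2)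
  finally show ?thesis .
qed

text \<open>At \<open>(y, z)\<close> the sum over \<open>h\<close> collapses to the tuple with
  support \<open>diffs x y\<close>. Its scalar is the product of \<open>card (U a) - 1\<close> over
  those \<open>a\<close> in \<open>supp n g\<close> with \<open>y a = x a\<close>, which are exactly
  the corner entries of the tensor product.\<close>

lemma CC_eq_cen:
  assumes "g \<in> EE n"
  shows "CC n U x g = (cen (supp n g) :: (nat \<Rightarrow> 'a, 'f) matrix)"
proof (intro ext)
  fix y z
  show "CC n U x g y z = (cen (supp n g) y z :: 'f)"
  proof (cases "y \<in> X \<and> z \<in> X")
    case False
    then show ?thesis
      by (auto simp: CC_def sum_matrix_apply mat_scale_def BB_diagonal_apply cen_def ten_def)
  next
    case True
    have eq: "supp n h = diffs x y \<longleftrightarrow> h = tup n (diffs x y)" if "h \<in> EE n" for h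
      using tup_supp[OF that] diffs_subset[of x y] by (auto simp: Int_absorb2)
    \<comment> \<open>This lets the bound by \<open>supp n (tup_inter n g h)\<close> be replaced by
      a bound by \<open>supp n g\<close>.\<close>
    have sub: "diffs y z \<subseteq> diffs x y" if "diffs x y = diffs x z"
      using that by (metis in_diffs_iff subsetI)
    let ?k = "of_nat (\<Prod>a\<in>supp n g - diffs x y. card (U a) - 1) :: 'f"
    let ?P = "diffs x y = diffs x z \<and> diffs y z \<subseteq> supp n g"
    have "CC n U x g y z = (\<Sum>h\<in>EE n. if h = tup n (diffs x y) then (if ?P then ?k else 0) else 0)"
      unfolding CC_def sum_matrix_apply mat_scale_def BB_diagonal_apply
    proof (intro sum.cong refl)
      fix h assume h: "h \<in> EE n"
      have "supp n (tup_diff n g h) = supp n g - supp n h"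
        "supp n (tup_inter n g h) = supp n g \<inter> supp n h"
        using supp_subset[of n g] by (auto simp: tup_diff_def tup_inter_def)
      then show "of_nat (kk n U (tup_diff n g h)) * (if y \<in> X \<and> z \<in> X \<and> supp n h = diffs x y \<and>
          supp n h = diffs x z \<and> diffs y z \<subseteq> supp n (tup_inter n g h) then 1 else 0)
        = (if h = tup n (diffs x y) then if ?P then ?k else 0 else 0)"
        using True sub by (auto simp: kk_def eq[OF h, symmetric])
    qed
    also have "\<dots> = (if ?P then ?k else 0)" by simp
    finally have "CC n U x g y z = (if ?P then ?k else 0)" .
    moreover have P_iff: "?P \<longleftrightarrow> (\<forall>a\<in>{1..n}. (x a = y a \<longleftrightarrow> x a = z a) \<and> (y a \<noteq> z a \<longrightarrow> a \<in> supp n g))"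
      unfolding set_eq_iff subset_iff in_diffs_iff by blast
    moreover have "(if ?P then ?k else 0)
        = (\<Prod>a\<in>{1..n}. (if a \<in> supp n g then local_central a else local_id) (y a) (z a))"
    proof (cases ?P)
      case P: True
      have "(\<Prod>a\<in>{1..n}. (if a \<in> supp n g then local_central a else local_id) (y a) (z a))
          = (\<Prod>a\<in>{1..n}. if a \<in> supp n g - diffs x y then of_nat (card (U a) - 1) else (1::'f))"
        using P[unfolded P_iff]
        by (intro prod.cong) (auto simp: local_central_def local_id_def diffs_def)
      also have "\<dots> = (\<Prod>a\<in>{1..n} \<inter> (supp n g - diffs x y). of_nat (card (U a) - 1))"
        by (rule prod.inter_restrict[symmetric]) simp
      also have "{1..n} \<inter> (supp n g - diffs x y) = supp n g - diffs x y"
        using supp_subset[of n g] by auto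
      finally show ?thesis using P by simp
    next
      case False
      then obtain a where a: "a \<in> {1..n}"
        "\<not> ((x a = y a \<longleftrightarrow> x a = z a) \<and> (y a \<noteq> z a \<longrightarrow> a \<in> supp n g))"
        unfolding P_iff by blast
      then have "(if a \<in> supp n g then local_central a else local_id) (y a) (z a) = (0::'f)"
        using local_factor_zero[of a "y a" "z a" "a \<in> supp n g"] by blast
      then have "(\<Prod>a\<in>{1..n}. (if a \<in> supp n g then local_central a else local_id) (y a) (z a)) = (0::'f)"
        using a(1) by (intro prod_zero) (simp, blast)
      then show ?thesis unfolding if_not_P[OF False] by (rule sym)
    qed
    ultimately show ?thesis using True by (simp add: cen_def ten_def)
  qed
qed

text \<open>Away from \<open>x a\<close> all entries of \<open>local_central a\<close> are 1, so
  only the identity factors outside \<open>G\<close> impose a condition.\<close>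

lemma cen_full_apply:
  assumes "y \<in> X" "z \<in> X" "diffs x y = {1..n}" "diffs x z = {1..n}"
  shows "cen G y z = (if diffs y z \<subseteq> G then 1 else (0::'f))"
proof -
  have "cen G y z = (\<Prod>a\<in>{1..n}. if a \<notin> G \<longrightarrow> y a = z a then 1 else (0::'f))"
    unfolding cen_def ten_def using assms diffs_full_D[OF assms(3)] diffs_full_D[OF assms(4)]
    by (auto simp: local_central_def local_id_def intro!: prod.cong)
  then show ?thesis by (auto simp: prod_if_one_zero diffs_def)
qed

text \<open>The defining sum gives membership in the algebra, which the tensor form does not
  show.\<close>

lemma CC_in_TT: "(CC n U x g :: (nat \<Rightarrow> 'a, 'f) matrix) \<in> TT n U x"
  unfolding TT_def CC_def BB_def
  by (intro gen_algebra_sum gen_algebra.scale gen_algebra.mult) (auto intro: gen_algebra.gen)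

lemma cen_in_center:
  assumes "G \<subseteq> {1..n}"
  shows "cen G \<in> center X (TT n U x)"
  unfolding TT_def
proof (rule center_gen_algebraI)
  show "cen G \<in> gen_algebra X (adj n U ` EE n \<union> dual_idem n U x ` EE n)"
    using CC_in_TT[of "tup n G"] CC_eq_cen[of "tup n G"] assms by (simp add: TT_def Int_absorb2)
  show "mat_mult X (cen G) N = mat_mult X N (cen G)"
    if "N \<in> adj n U ` EE n \<union> dual_idem n U x ` EE n" for N
    by (rule cen_commute_generator[OF that])
qed (auto simp: cen_def ten_def)

section \<open>Invariance under coordinate permutations fixing the base point\<close>

definition admissible :: "(nat \<Rightarrow> 'a \<Rightarrow> 'a) \<Rightarrow> bool" where
  "admissible \<sigma> \<longleftrightarrow> (\<forall>a\<in>{1..n}. bij_betw (\<sigma> a) (U a) (U a) \<and> \<sigma> a (x a) = x a)"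

definition act :: "(nat \<Rightarrow> 'a \<Rightarrow> 'a) \<Rightarrow> (nat \<Rightarrow> 'a) \<Rightarrow> nat \<Rightarrow> 'a" where
  "act \<sigma> y = (\<lambda>a\<in>{1..n}. \<sigma> a (y a))"

lemma act_in_X: "admissible \<sigma> \<Longrightarrow> y \<in> X \<Longrightarrow> act \<sigma> y \<in> X"
  by (auto simp: admissible_def act_def XX_def dest!: bspec bij_betwE)

lemma act_apply_eq_iff:
  assumes "admissible \<sigma>" "y \<in> X" "z \<in> X" "a \<in> {1..n}"
  shows "act \<sigma> y a = act \<sigma> z a \<longleftrightarrow> y a = z a"
proof -
  have "inj_on (\<sigma> a) (U a)"
    using assms by (auto simp: admissible_def bij_betw_def)
  then show ?thesis
    using assms X_D by (simp add: act_def inj_on_eq_iff)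
qed

lemma act_base_point: "admissible \<sigma> \<Longrightarrow> act \<sigma> x = x"
  using base_point by (auto simp: act_def admissible_def XX_def PiE_iff extensional_def fun_eq_iff)

lemma diffs_act: "admissible \<sigma> \<Longrightarrow> y \<in> X \<Longrightarrow> z \<in> X \<Longrightarrow> diffs (act \<sigma> y) (act \<sigma> z) = diffs y z"
  using act_apply_eq_iff by (auto simp: diffs_def)

lemma act_eq_iff: "admissible \<sigma> \<Longrightarrow> y \<in> X \<Longrightarrow> z \<in> X \<Longrightarrow> act \<sigma> y = act \<sigma> z \<longleftrightarrow> y = z"
  by (metis X_eqI act_apply_eq_iff)

lemma bij_betw_act:
  assumes "admissible \<sigma>"
  shows "bij_betw (act \<sigma>) X X"
proof -
  have "inj_on (act \<sigma>) X" using act_eq_iff[OF assms] by (auto intro: inj_onI)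
  moreover have "act \<sigma> ` X \<subseteq> X" using act_in_X[OF assms] by auto
  ultimately show ?thesis by (simp add: bij_betw_def endo_inj_surj)
qed

text \<open>The generators depend only on equality and difference sets, which
  \<open>act \<sigma>\<close> preserves. For products the summation index is moved along the
  bijection \<open>act \<sigma>\<close>.\<close>

lemma TT_invariant:
  fixes M :: "(nat \<Rightarrow> 'a, 'f) matrix"
  assumes "M \<in> TT n U x" "admissible \<sigma>" "y \<in> X" "z \<in> X"
  shows "M (act \<sigma> y) (act \<sigma> z) = M y z"
  using assms(1,3,4) unfolding TT_def
proof (induction arbitrary: y z)
  case one
  then show ?case using assms(2) by (simp add: mat_one_def act_eq_iff act_in_X)
next
  case (gen M)
  have "diffs x (act \<sigma> v) = diffs x v" if "v \<in> X" for v
    using diffs_act[OF assms(2) base_point that] by (simp add: act_base_point[OF assms(2)])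
  then show ?case
    using gen assms(2) by (auto simp: adj_def dual_idem_def RR_iff diffs_act act_in_X act_eq_iff)
next
  case (mult M N)
  have "(\<Sum>w\<in>X. M (act \<sigma> y) w * N w (act \<sigma> z))
      = (\<Sum>w\<in>X. M (act \<sigma> y) (act \<sigma> w) * N (act \<sigma> w) (act \<sigma> z))"
    by (rule sum.reindex_bij_betw[OF bij_betw_act[OF assms(2)], symmetric])
  then show ?case using mult by (simp add: mat_mult_def)
qed (simp_all add: mat_scale_def)

lemma TT_support:
  fixes M :: "(nat \<Rightarrow> 'a, 'f) matrix"
  assumes "M \<in> TT n U x" "y \<notin> X \<or> z \<notin> X"
  shows "M y z = 0"
  using assms unfolding TT_def
  by (induction arbitrary: y z)
    (auto simp: mat_one_def adj_def dual_idem_def RR_iff mat_mult_def mat_scale_def)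

lemma TT_full_block_orbit:
  fixes M :: "(nat \<Rightarrow> 'a, 'f) matrix"
  assumes M: "M \<in> TT n U x"
    and X: "y \<in> X" "z \<in> X" "y' \<in> X" "z' \<in> X"
    and full: "diffs x y = {1..n}" "diffs x z = {1..n}" "diffs x y' = {1..n}" "diffs x z' = {1..n}"
    and eq: "diffs y z = diffs y' z'"
  shows "M y z = M y' z'"
proof -
  \<comment> \<open>\<open>\<sigma> a\<close> sends \<open>y a\<close> to \<open>y' a\<close> and
    \<open>z a\<close> to \<open>z' a\<close>. It only moves values in \<open>U a\<close> other than
    \<open>x a\<close>, hence fixes \<open>x a\<close>.\<close>
  define \<sigma> where
    "\<sigma> a = transpose (transpose (y a) (y' a) (z a)) (z' a) \<circ> transpose (y a) (y' a)" for a
  have ne: "y a \<noteq> x a" "z a \<noteq> x a" "y' a \<noteq> x a" "z' a \<noteq> x a" "y a = z a \<longleftrightarrow> y' a = z' a"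
    if "a \<in> {1..n}" for a
  proof -
    show "y a \<noteq> x a" "z a \<noteq> x a" "y' a \<noteq> x a" "z' a \<noteq> x a"
      using full[THEN diffs_full_D, OF that] .
    have "a \<in> diffs y z \<longleftrightarrow> a \<in> diffs y' z'" using eq by simp
    then show "y a = z a \<longleftrightarrow> y' a = z' a" using that by (simp add: diffs_def)
  qed
  have "admissible \<sigma>"
    unfolding admissible_def
  proof (intro ballI conjI)
    fix a assume a: "a \<in> {1..n}"
    show "\<sigma> a (x a) = x a"
      using ne[OF a] by (auto simp: \<sigma>_def transpose_def)
    have "inj (\<sigma> a)"
      by (auto simp: \<sigma>_def intro: inj_compose)
    then have "inj_on (\<sigma> a) (U a)"
      by (rule inj_on_subset) simp
    moreover have "\<sigma> a ` U a \<subseteq> U a"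
      using X[THEN X_D, OF a] by (auto simp: \<sigma>_def transpose_def)
    ultimately show "bij_betw (\<sigma> a) (U a) (U a)"
      using finite_U[OF a] by (simp add: bij_betw_def endo_inj_surj)
  qed
  moreover have "act \<sigma> y = y'" "act \<sigma> z = z'"
  proof -
    have "\<sigma> a (y a) = y' a" "\<sigma> a (z a) = z' a" if "a \<in> {1..n}" for a
      unfolding \<sigma>_def by (rule transpose_comp_pair[OF ne(5)[OF that]])+
    then show "act \<sigma> y = y'" "act \<sigma> z = z'"
      using X act_in_X[OF calculation] by (auto intro!: X_eqI simp: act_def)
  qed
  ultimately show ?thesis using TT_invariant[OF M _ X(1,2)] by metis
qed

section \<open>The block of points differing from \<open>x\<close> everywhere\<close>

lemma diffs_full_subset:
  assumes "y \<in> X" "z \<in> X" "diffs x y = {1..n}" "diffs x z = {1..n}"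
  shows "diffs y z \<subseteq> circ U {1..n}"
proof
  fix a assume a: "a \<in> diffs y z"
  then have n: "a \<in> {1..n}" by (simp add: diffs_def)
  have "x a \<noteq> y a" "x a \<noteq> z a" "y a \<noteq> z a"
    using a diffs_full_D[OF assms(3) n] diffs_full_D[OF assms(4) n] by (metis in_diffs_iff)+
  then have "card {x a, y a, z a} = 3" by simp
  moreover have "card {x a, y a, z a} \<le> card (U a)"
    using X_D[OF assms(1) n] X_D[OF assms(2) n] X_D[OF base_point n] finite_U[OF n]
    by (intro card_mono) auto
  ultimately show "a \<in> circ U {1..n}" using n by (simp add: circ_def)
qed

text \<open>Each \<open>U a\<close> has a value other than \<open>x a\<close>; on \<open>D\<close>
  the bound \<open>card (U a) > 2\<close> leaves room for a second one.\<close>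

lemma obtain_full_pair:
  assumes "D \<subseteq> circ U {1..n}"
  obtains y z where "y \<in> X" "z \<in> X" "diffs x y = {1..n}" "diffs x z = {1..n}" "diffs y z = D"
proof -
  have ex: "\<exists>p. fst p \<in> U a \<and> snd p \<in> U a \<and> fst p \<noteq> x a \<and> snd p \<noteq> x a \<and> (fst p \<noteq> snd p \<longleftrightarrow> a \<in> D)"
    if a: "a \<in> {1..n}" for a
  proof -
    have "card (U a - {x a}) \<ge> 1"
      using card_U[OF a] X_D[OF base_point a] by simp
    then have "U a - {x a} \<noteq> {}" by (metis card.empty not_one_le_zero)
    then obtain u where u: "u \<in> U a - {x a}" by blast
    show ?thesis
    proof (cases "a \<in> D")
      case True
      then have "card (U a) > 2" using assms by (auto simp: circ_def)
      then have "card (U a - {x a} - {u}) \<ge> 1"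
        using X_D[OF base_point a] u by simp
      then have "U a - {x a} - {u} \<noteq> {}" by (metis card.empty not_one_le_zero)
      then obtain v where "v \<in> U a - {x a} - {u}" by blast
      then show ?thesis using u True by (intro exI[of _ "(u, v)"]) auto
    next
      case False
      then show ?thesis using u by (intro exI[of _ "(u, u)"]) auto
    qed
  qed
  then obtain p where p: "\<And>a. a \<in> {1..n} \<Longrightarrow> fst (p a) \<in> U a \<and> snd (p a) \<in> U a \<and>
      x a \<noteq> fst (p a) \<and> x a \<noteq> snd (p a) \<and> (fst (p a) \<noteq> snd (p a) \<longleftrightarrow> a \<in> D)"
    by metis
  have "D \<subseteq> {1..n}" using assms by (auto simp: circ_def)
  then show ?thesis
    using p by (intro that[of "\<lambda>a\<in>{1..n}. fst (p a)" "\<lambda>a\<in>{1..n}. snd (p a)"])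
      (auto simp: XX_def diffs_def)
qed

lemma center_eq_zero:
  fixes M :: "(nat \<Rightarrow> 'a, 'f) matrix"
  assumes M: "M \<in> center X (TT n U x)"
    and zero: "\<And>y z. y \<in> X \<Longrightarrow> z \<in> X \<Longrightarrow> diffs x y = {1..n} \<Longrightarrow> diffs x z = {1..n} \<Longrightarrow> M y z = 0"
  shows "M = 0"
proof -
  have "M y z = 0" if yz: "y \<in> X" "z \<in> X" for y z
  proof -
    define S where "S = diffs x z"
    have S: "S \<subseteq> {1..n}" by (simp add: S_def diffs_subset)
    obtain e e' where e: "e \<in> X" "diffs x e = {1..n}"
      and "e' \<in> X" "diffs x e' = {1..n}" "diffs e e' = {}"
      using obtain_full_pair[OF empty_subsetI] by metis
    \<comment> \<open>The coordinates where \<open>z\<close> agrees with \<open>x\<close> are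
      replaced by those of \<open>e\<close>, so \<open>z'\<close> lies in the full block.\<close>
    define z' where "z' = (\<lambda>a\<in>{1..n}. if a \<in> S then z a else e a)"
    have "x a \<noteq> z' a" if a: "a \<in> {1..n}" for a
    proof (cases "a \<in> S")
      case True
      then show ?thesis using a unfolding S_def in_diffs_iff by (simp add: z'_def S_def in_diffs_iff)
    next
      case False
      then show ?thesis using a diffs_full_D[OF e(2) a] by (simp add: z'_def)
    qed
    then have z': "z' \<in> X" "diffs x z' = {1..n}"
      using X_D[OF yz(2)] X_D[OF e(1)] diffs_full_I by (auto simp: z'_def XX_def)
    \<comment> \<open>\<open>z\<close> is the only point of support \<open>S\<close> that \<open>N\<close> connects to \<open>z'\<close>, so \<open>M N\<close> has entry \<open>M y z\<close> at
      \<open>(y, z')\<close>, while \<open>N M\<close> only sees entries of \<open>M\<close> in the full-support block.\<close>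
    define N :: "(nat \<Rightarrow> 'a, 'f) matrix" where
      "N = mat_mult X (mat_mult X (dual_idem n U x (tup n S)) (adj n U (tup n ({1..n} - S))))
        (dual_idem n U x (tup n {1..n}))"
    have N: "N v w = (if v \<in> X \<and> w \<in> X \<and> diffs x v = S \<and> diffs x w = {1..n}
        \<and> diffs v w = {1..n} - S then 1 else 0)" for v w
      using S unfolding N_def block_adj_apply by (auto simp: Int_absorb2)
    have "N \<in> TT n U x"
      unfolding N_def TT_def by (intro gen_algebra.mult) (auto intro: gen_algebra.gen)
    then have comm: "mat_mult X M N y z' = mat_mult X N M y z'"
      using M by (simp add: center_def)
    have "N w z' = (if w = z then 1 else 0)" if w: "w \<in> X" for w
    proof -
      \<comment> \<open>On \<open>S\<close> the second condition forces
        \<open>w a = z' a = z a\<close>; off \<open>S\<close> the first forces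
        \<open>w a = x a = z a\<close>.\<close>
      have "diffs x w = S \<and> diffs w z' = {1..n} - S \<longleftrightarrow> w = z"
      proof
        assume l: "diffs x w = S \<and> diffs w z' = {1..n} - S"
        show "w = z"
        proof (rule X_eqI[OF w yz(2)])
          fix a assume a: "a \<in> {1..n}"
          show "w a = z a"
          proof (cases "a \<in> S")
            case True
            then have "a \<notin> diffs w z'" using l by auto
            then show ?thesis using a True by (simp add: diffs_def z'_def)
          next
            case False
            then have "a \<notin> diffs x w" "a \<notin> diffs x z" using l by (auto simp: S_def)
            then show ?thesis using a by (simp add: diffs_def)
          qed
        qed
      next
        assume "w = z"
        moreover have "z a \<noteq> z' a \<longleftrightarrow> a \<notin> S" if a: "a \<in> {1..n}" for a
        proof (cases "a \<in> S")
          case True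
          then show ?thesis using a by (simp add: z'_def)
        next
          case False
          then have "x a = z a" using a by (simp add: S_def in_diffs_iff)
          then show ?thesis using False a diffs_full_D[OF e(2) a] by (simp add: z'_def)
        qed
        ultimately show "diffs x w = S \<and> diffs w z' = {1..n} - S"
          by (auto simp: in_diffs_iff S_def)
      qed
      then show ?thesis using w z' by (simp add: N)
    qed
    then have "mat_mult X M N y z' = (\<Sum>w\<in>X. if w = z then M y z else 0)"
      unfolding mat_mult_def by (intro sum.cong) auto
    then have "mat_mult X M N y z' = M y z"
      using yz by simp
    moreover have "mat_mult X N M y z' = 0"
      unfolding mat_mult_def using zero z' by (intro sum.neutral) (auto simp: N)
    ultimately show ?thesis using comm by simp
  qed
  moreover have "M y z = 0" if "y \<notin> X \<or> z \<notin> X" for y z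
    using M that TT_support by (auto simp: center_def)
  ultimately show ?thesis by (auto simp: fun_eq_iff)
qed

section \<open>Independence and span of the central matrices\<close>

lemma finite_circ: "finite (circ U {1..n})"
  by (simp add: circ_def)

lemma sum_cen_full_apply:
  assumes "y \<in> X" "z \<in> X" "diffs x y = {1..n}" "diffs x z = {1..n}"
  shows "(\<Sum>G\<in>Pow (circ U {1..n}). mat_scale (c G) (cen G)) y z
    = (\<Sum>G\<in>{G\<in>Pow (circ U {1..n}). diffs y z \<subseteq> G}. c G)"
proof -
  have "(\<Sum>G\<in>Pow (circ U {1..n}). mat_scale (c G) (cen G)) y z
      = (\<Sum>G\<in>Pow (circ U {1..n}). if diffs y z \<subseteq> G then c G else 0)"
    unfolding sum_matrix_apply mat_scale_def cen_full_apply[OF assms] by (intro sum.cong) auto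
  then show ?thesis
    using finite_circ by (simp add: sum.inter_filter del: Pow_iff)
qed

text \<open>Every \<open>D\<close> is the difference set of some pair in the full block, so
  evaluating there makes each superset sum vanish.\<close>

lemma cen_coefficients_zero:
  assumes "(\<Sum>G\<in>Pow (circ U {1..n}). mat_scale (c G) (cen G)) = 0" "G \<subseteq> circ U {1..n}"
  shows "c G = 0"
proof (rule superset_sum_eq_zeroD[OF finite_circ _ assms(2)])
  fix D assume "D \<subseteq> circ U {1..n}"
  then obtain y z where "y \<in> X" "z \<in> X" "diffs x y = {1..n}" "diffs x z = {1..n}" "diffs y z = D"
    by (rule obtain_full_pair)
  then show "(\<Sum>G\<in>{G\<in>Pow (circ U {1..n}). D \<subseteq> G}. c G) = 0"
    using sum_cen_full_apply[of y z c] assms(1) by simp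
qed

text \<open>Evaluation at a pair with difference set \<open>A\<close> detects inclusion. Injectivity
  turns coefficients indexed by sets into coefficients indexed by vectors.\<close>

lemma inj_on_cen: "inj_on cen (Pow (circ U {1..n}))"
proof (rule inj_onI)
  fix G H assume G: "G \<in> Pow (circ U {1..n})" and H: "H \<in> Pow (circ U {1..n})" and eq: "cen G = cen H"
  have "A \<subseteq> B" if A: "A \<subseteq> circ U {1..n}" and eq: "cen A = cen B" for A B
  proof -
    obtain y z where "y \<in> X" "z \<in> X" "diffs x y = {1..n}" "diffs x z = {1..n}" "diffs y z = A"
      by (rule obtain_full_pair[OF A])
    then show ?thesis
      using cen_full_apply[of y z A] cen_full_apply[of y z B] eq by (auto split: if_splits)
  qed
  then show "G = H" using G H eq by (metis Pow_iff subset_antisym)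
qed

lemma independent_cen: "mat.independent (cen ` Pow (circ U {1..n}))"
proof -
  have "c v = 0" if "(\<Sum>v\<in>cen ` Pow (circ U {1..n}). mat_scale (c v) v) = 0"
    "v \<in> cen ` Pow (circ U {1..n})" for c :: "(nat \<Rightarrow> 'a, 'f) matrix \<Rightarrow> 'f" and v
    using cen_coefficients_zero[of "\<lambda>G. c (cen G)"] that
    by (auto simp: sum.reindex[OF inj_on_cen] o_def)
  then show ?thesis
    using mat.dependent_finite[of "cen ` Pow (circ U {1..n})"] finite_circ by auto
qed

lemma span_cen: "mat.span (cen ` Pow (circ U {1..n})) = center X (TT n U x)"
proof
  have sub: "mat.subspace (center X (TT n U x) :: (nat \<Rightarrow> 'a, 'f) matrix set)"
    unfolding TT_def by (rule subspace_center)
  show le: "mat.span (cen ` Pow (circ U {1..n})) \<subseteq> center X (TT n U x)"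
    by (intro mat.span_minimal sub) (auto intro!: cen_in_center simp: circ_def)
  show "center X (TT n U x) \<subseteq> mat.span (cen ` Pow (circ U {1..n}))"
  proof
    fix M :: "(nat \<Rightarrow> 'a, 'f) matrix"
    assume M: "M \<in> center X (TT n U x)"
    define Q where "Q D p \<longleftrightarrow> fst p \<in> X \<and> snd p \<in> X \<and> diffs x (fst p) = {1..n} \<and>
      diffs x (snd p) = {1..n} \<and> diffs (fst p) (snd p) = D" for D p
    \<comment> \<open>The value of \<open>M\<close> at a chosen representative pair. It is arbitrary
      where no pair exists, but the comparison with \<open>M\<close> only uses sets
      \<open>diffs y z\<close> from the full block.\<close>
    define m where "m D = M (fst (SOME p. Q D p)) (snd (SOME p. Q D p))" for D
    have m: "M y z = m (diffs y z)"
      if "y \<in> X" "z \<in> X" "diffs x y = {1..n}" "diffs x z = {1..n}" for y z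
    proof -
      have "Q (diffs y z) (y, z)" using that by (simp add: Q_def)
      then have "Q (diffs y z) (SOME p. Q (diffs y z) p)" by (rule someI)
      then obtain p where p: "Q (diffs y z) p" and m_p: "m (diffs y z) = M (fst p) (snd p)"
        unfolding m_def by blast
      have "M \<in> TT n U x" using M by (simp add: center_def)
      then have "M y z = M (fst p) (snd p)"
        using that p unfolding Q_def by (elim conjE) (rule TT_full_block_orbit, assumption+, rule sym)
      then show ?thesis using m_p by simp
    qed
    obtain c where c: "\<And>D. D \<subseteq> circ U {1..n} \<Longrightarrow>
        (\<Sum>G\<in>{G\<in>Pow (circ U {1..n}). D \<subseteq> G}. c G) = m D"
      using superset_sum_solvable[OF finite_circ, of m] by blast
    \<comment> \<open>By the choice of \<open>c\<close>, this combination has the same full block as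
      \<open>M\<close>, so the central matrix \<open>M - K\<close> vanishes.\<close>
    define K where "K = (\<Sum>G\<in>Pow (circ U {1..n}). mat_scale (c G) (cen G))"
    have K: "K \<in> mat.span (cen ` Pow (circ U {1..n}))"
      unfolding K_def by (intro mat.span_sum mat.span_scale mat.span_base) auto
    have "M - K = 0"
    proof (rule center_eq_zero)
      show "M - K \<in> center X (TT n U x)"
        using mat.subspace_diff[OF sub M] K le by blast
      show "(M - K) y z = 0"
        if "y \<in> X" "z \<in> X" "diffs x y = {1..n}" "diffs x z = {1..n}" for y z
        using m[OF that] c[OF diffs_full_subset[OF that]]
        unfolding K_def minus_apply sum_cen_full_apply[OF that] by simp
    qed
    then show "M \<in> mat.span (cen ` Pow (circ U {1..n}))" using K by simp
  qed
qed

lemma CC_basis_eq: "CC_basis n U x = cen ` Pow (circ U {1..n})"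
proof
  show "CC_basis n U x \<subseteq> cen ` Pow (circ U {1..n})"
    by (auto simp: CC_basis_def all_one_PP_iff CC_eq_cen)
  show "cen ` Pow (circ U {1..n}) \<subseteq> CC_basis n U x"
  proof
    fix M assume "M \<in> cen ` Pow (circ U {1..n})"
    then obtain G where G: "G \<subseteq> circ U {1..n}" "M = cen G" by auto
    then have "G \<subseteq> {1..n}" by (auto simp: circ_def)
    then have "supp n (tup n G) = G" by auto
    then have "M = CC n U x (tup n G)" "(all_one n, tup n G, all_one n) \<in> PP n U"
      using G by (simp_all add: CC_eq_cen all_one_PP_iff)
    then show "M \<in> CC_basis n U x"
      unfolding CC_basis_def by blast
  qed
qed

end

section \<open>Structure constants of the center\<close>

theorem theorem4p13:
  fixes n :: nat and U :: "nat \<Rightarrow> 'a set" and x :: "nat \<Rightarrow> 'a" and g h i :: "nat \<Rightarrow> nat"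
  assumes "n \<ge> 1"
    and "\<And>a. a \<in> {1..n} \<Longrightarrow> finite (U a) \<and> card (U a) \<ge> 2"
    and "x \<in> XX n U"
    and "g \<in> EE n" and "h \<in> EE n" and "i \<in> EE n"
    and "(all_one n, g, all_one n) \<in> PP n U"
    and "(all_one n, h, all_one n) \<in> PP n U"
    and "(all_one n, i, all_one n) \<in> PP n U"
  shows "(all_one n, tup_union n g h, all_one n) \<in> PP n U \<and>
    (mat.independent (CC_basis n U x :: (nat \<Rightarrow> 'a, 'f::field) matrix set) \<and>
     mat.span (CC_basis n U x :: (nat \<Rightarrow> 'a, 'f) matrix set) = center (XX n U) (TT n U x)) \<and>
    mat.representation (CC_basis n U x :: (nat \<Rightarrow> 'a, 'f) matrix set)
        (mat_mult (XX n U) (CC n U x g) (CC n U x h)) (CC n U x i) =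
      (if i = tup_union n g h then 1 else 0) * of_nat (kk n U (tup_inter n g h))"
proof -
  interpret factorial_scheme n U x "TYPE('f)"
    using assms(2,3) by unfold_locales auto
  have supp_union: "supp n (tup_union n g h) = supp n g \<union> supp n h"
    and supp_inter: "supp n (tup_inter n g h) = supp n g \<inter> supp n h"
    using supp_subset[of n g] supp_subset[of n h] by (auto simp: tup_union_def tup_inter_def)
  have union: "tup_union n g h \<in> EE n" "supp n (tup_union n g h) \<subseteq> circ U {1..n}"
    using assms(7,8) by (simp_all add: supp_union all_one_PP_iff) (simp add: tup_union_def)
  have indep: "mat.independent (CC_basis n U x :: (nat \<Rightarrow> 'a, 'f) matrix set)"
    and span: "mat.span (CC_basis n U x :: (nat \<Rightarrow> 'a, 'f) matrix set) = center (XX n U) (TT n U x)"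
    by (simp_all add: CC_basis_eq independent_cen span_cen)
  have prod: "mat_mult (XX n U) (CC n U x g) (CC n U x h)
      = mat_scale (of_nat (kk n U (tup_inter n g h)) :: 'f) (CC n U x (tup_union n g h))"
    using cen_mult[OF supp_subset[of n g] supp_subset[of n h]] assms(4,5) union(1)
    by (simp add: CC_eq_cen kk_def supp_union supp_inter)
  have basis: "(CC n U x (tup_union n g h) :: (nat \<Rightarrow> 'a, 'f) matrix) \<in> CC_basis n U x"
    using union by (auto simp: CC_basis_def all_one_PP_iff)
  \<comment> \<open>\<open>mat.representation\<close> takes a basis vector, not an index, so the
    Kronecker delta requires that equal vectors have equal indices.\<close>
  have "(CC n U x i :: (nat \<Rightarrow> 'a, 'f) matrix) = CC n U x (tup_union n g h)
      \<longleftrightarrow> supp n i = supp n (tup_union n g h)"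
    using inj_on_eq_iff[OF inj_on_cen] assms(6,9) union by (simp add: CC_eq_cen all_one_PP_iff)
  also have "\<dots> \<longleftrightarrow> i = tup_union n g h"
    using tup_supp[OF assms(6)] tup_supp[OF union(1)] by metis
  finally have eq: "(CC n U x i :: (nat \<Rightarrow> 'a, 'f) matrix) = CC n U x (tup_union n g h)
      \<longleftrightarrow> i = tup_union n g h" .
  have "mat.representation (CC_basis n U x :: (nat \<Rightarrow> 'a, 'f) matrix set)
        (mat_mult (XX n U) (CC n U x g) (CC n U x h)) (CC n U x i) =
      (if i = tup_union n g h then 1 else 0) * of_nat (kk n U (tup_inter n g h))"
    unfolding prod mat.representation_scale[OF indep mat.span_base[OF basis]]
      mat.representation_basis[OF indep basis] by (simp add: eq)
  then show ?thesis
    using indep span union by (simp add: all_one_PP_iff)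
qed

end
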